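(* Let $\alpha,\beta,\mu,\nu\in\mathbb C$, let $U$ be an open set of points $z=(z_{-1},z_1,z_{-2},z_2,z_{-3},z_3)$, and let the contour $]0,1[\ni s\mapsto\tau(s)$, denoted $\gamma$, satisfy for $z\in U$ both $$(z_1-\tau^{-1}z_{-2})^{\alpha+\nu}(z_2+\tau^{-1}z_{-1})^{\beta+\nu}\tau^{\nu-1}\Big|_{\tau(0)}^{\tau(1)}=0$$ and $$(z_1-\tau^{-1}z_{-2})^{\alpha+\nu}(z_2+\tau^{-1}z_{-1})^{\beta+\nu}\tau^{\nu}\Big|_{\tau(0)}^{\tau(1)}=0.$$ Set $$K_{\alpha,\beta,\mu,\nu}(z):=\int_\gamma(z_1-\tau^{-1}z_{-2})^{\alpha+\nu}(z_2+\tau^{-1}z_{-1})^{\beta+\nu}z_3^{\mu}\,\tau^{\nu-1}\frac{d\tau}{2\pi i}$$ and assume that we are allowed to differentiate under the integral sign. Then $$B_{-1,2}K_{\alpha,\beta,\mu,\nu}=(\beta+\nu)K_{\alpha+1,\beta-1,\mu,\nu},$$ $$B_{1,-2}K_{\alpha,\beta,\mu,\nu}=-(\alpha+\nu)K_{\alpha-1,\beta+1,\mu,\nu},$$ $$B_{1,2}K_{\alpha,\beta,\mu,\nu}=(\nu+1)K_{\alpha-1,\beta-1,\mu,\nu+1},$$ $$B_{-1,-2}K_{\alpha,\beta,\mu,\nu}=-(\alpha+\beta+\nu+1)K_{\alpha+1,\beta+1,\mu,\nu-1},$$ $$B_{1,-3}K_{\alpha,\beta,\mu,\nu}=-(\alpha+\nu)K_{\alpha-1,\beta,\mu+1,\nu},$$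 $$B_{-1,-3}K_{\alpha,\beta,\mu,\nu}=-(\beta+\nu)K_{\alpha+1,\beta,\mu+1,\nu-1},$$ $$B_{2,-3}K_{\alpha,\beta,\mu,\nu}=-(\beta+\nu)K_{\alpha,\beta-1,\mu+1,\nu},$$ $$B_{-2,-3}K_{\alpha,\beta,\mu,\nu}=(\alpha+\nu)K_{\alpha,\beta+1,\mu+1,\nu-1}.$$
   Context: For $i,j\in\{-3,-2,-1,1,2,3\}$, $|i|\neq|j|$, $B_{i,j}:=z_{-i}\partial_{z_j}-z_{-j}\partial_{z_i}$. Conventions on contours: $\gamma$ is a piecewise $C^1$ curve in $\mathbb C\setminus\{0\}$ independent of $z\in U$; the powers are holomorphic in $z$ with branches chosen continuously along $\gamma$, the same branches of the logarithms of $\tau$, $z_1-\tau^{-1}z_{-2}$, $z_2+\tau^{-1}z_{-1}$, $z_3$ being used for all values of the parameters; $G(\tau)\big|_{\tau(0)}^{\tau(1)}=0$ means that $G(\tau(s))$ has limits as $s\to0$ and $s\to1$ and that their difference vanishes. All functions $K$ occurring are defined by the same formula with the same contour $\gamma$, and the integrals on both sides of each relation are assumed to converge absolutely. *)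

theory Defs
  imports "HOL-Analysis.Analysis"
begin

text \<open>The index set \<open>{-3,-2,-1,1,2,3}\<close>: \<open>Mk\<close> stands for \<open>-k\<close> and \<open>Pk\<close> for \<open>k\<close>.\<close>

datatype idx = M3 | M2 | M1 | P1 | P2 | P3

lemma UNIV_idx: "(UNIV :: idx set) = {M3, M2, M1, P1, P2, P3}"
  using idx.exhaust by blast

instance idx :: finite
  by standard (simp add: UNIV_idx)

instantiation idx :: uminus
begin

primrec uminus_idx :: "idx \<Rightarrow> idx" where
  "- M3 = P3"
| "- M2 = P2"
| "- M1 = P1"
| "- P1 = M1"
| "- P2 = M2"
| "- P3 = M3"

instance ..

end

definition upd :: "complex ^ idx \<Rightarrow> idx \<Rightarrow> complex \<Rightarrow> complex ^ idx" where
  "upd z i w = (\<chi> k. if k = i then w else z $ k)"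

definition pd :: "idx \<Rightarrow> (complex ^ idx \<Rightarrow> complex) \<Rightarrow> complex ^ idx \<Rightarrow> complex" where
  "pd i F z = deriv (\<lambda>w. F (upd z i w)) (z $ i)"

definition B :: "idx \<Rightarrow> idx \<Rightarrow> (complex ^ idx \<Rightarrow> complex) \<Rightarrow> complex ^ idx \<Rightarrow> complex" where
  "B i j F z = z $ (- i) * pd j F z - z $ (- j) * pd i F z"

text \<open>Holomorphy in several variables: Frechet differentiability with a complex-linear derivative.\<close>

definition holo_on :: "(complex ^ idx \<Rightarrow> complex) \<Rightarrow> (complex ^ idx) set \<Rightarrow> bool" where
  "holo_on F U \<longleftrightarrow>
     (\<forall>z\<in>U. \<exists>D. (F has_derivative D) (at z) \<and> (\<forall>c v. D (c *s v) = c * D v))"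

text \<open>
  A contour together with the branches of the logarithms that define all powers. The branches are
  functions of the curve parameter \<open>s\<close>, not of the point \<open>\<tau>(s)\<close>, because the curve may
  return to the same point with a different branch.
\<close>

record branched_contour =
  curve :: "real \<Rightarrow> complex"
  log_curve :: "real \<Rightarrow> complex"
  log1 :: "complex ^ idx \<Rightarrow> real \<Rightarrow> complex"
  log2 :: "complex ^ idx \<Rightarrow> real \<Rightarrow> complex"
  log3 :: "complex ^ idx \<Rightarrow> complex"

definition log_branch ::
  "(complex ^ idx) set \<Rightarrow> (complex ^ idx \<Rightarrow> real \<Rightarrow> complex) \<Rightarrow>
   (complex ^ idx \<Rightarrow> real \<Rightarrow> complex) \<Rightarrow> bool" where
  "log_branch U A L \<longleftrightarrow>
     (\<forall>z\<in>U. \<forall>s\<in>{0<..<1}. exp (L z s) = A z s) \<and>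
     (\<forall>z\<in>U. continuous_on {0<..<1} (L z)) \<and>
     (\<forall>s\<in>{0<..<1}. holo_on (\<lambda>z. L z s) U)"

definition admissible :: "(complex ^ idx) set \<Rightarrow> branched_contour \<Rightarrow> bool" where
  "admissible U \<gamma> \<longleftrightarrow>
     curve \<gamma> piecewise_C1_differentiable_on {0<..<1} \<and>
     (\<forall>s\<in>{0<..<1}. curve \<gamma> s \<noteq> 0) \<and>
     continuous_on {0<..<1} (log_curve \<gamma>) \<and>
     (\<forall>s\<in>{0<..<1}. exp (log_curve \<gamma> s) = curve \<gamma> s) \<and>
     log_branch U (\<lambda>z s. z $ P1 - inverse (curve \<gamma> s) * z $ M2) (log1 \<gamma>) \<and>
     log_branch U (\<lambda>z s. z $ P2 + inverse (curve \<gamma> s) * z $ M1) (log2 \<gamma>) \<and>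
     holo_on (log3 \<gamma>) U \<and> (\<forall>z\<in>U. exp (log3 \<gamma> z) = z $ P3)"

text \<open>\<open>pw \<gamma> a b c z s\<close> is
  \<open>(z\<^sub>1 - \<tau>\<^sup>-\<^sup>1 z\<^sub>-\<^sub>2)\<^sup>a (z\<^sub>2 + \<tau>\<^sup>-\<^sup>1 z\<^sub>-\<^sub>1)\<^sup>b \<tau>\<^sup>c\<close> at \<open>\<tau> = \<tau>(s)\<close>.\<close>

definition pw ::
  "branched_contour \<Rightarrow> complex \<Rightarrow> complex \<Rightarrow> complex \<Rightarrow> complex ^ idx \<Rightarrow> real \<Rightarrow> complex" where
  "pw \<gamma> a b c z s = exp (a * log1 \<gamma> z s) * exp (b * log2 \<gamma> z s) * exp (c * log_curve \<gamma> s)"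

definition boundary_vanishes :: "(real \<Rightarrow> complex) \<Rightarrow> bool" where
  "boundary_vanishes G \<longleftrightarrow>
     (\<exists>l0 l1. (G \<longlongrightarrow> l0) (at_right 0) \<and> (G \<longlongrightarrow> l1) (at_left 1) \<and> l1 - l0 = 0)"

text \<open>The integrand of \<open>K\<close> pulled back to \<open>]0,1[\<close>, including \<open>d\<tau> / (2 \<pi> \<i>) = \<tau>'(s) ds / (2 \<pi> \<i>)\<close>.
  The derivative may fail to exist at finitely many \<open>s\<close>, which does not affect the integral.\<close>

definition kern ::
  "branched_contour \<Rightarrow> complex \<Rightarrow> complex \<Rightarrow> complex \<Rightarrow> complex \<Rightarrow>
   complex ^ idx \<Rightarrow> real \<Rightarrow> complex" where
  "kern \<gamma> \<alpha> \<beta> \<mu> \<nu> z s =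
     pw \<gamma> (\<alpha> + \<nu>) (\<beta> + \<nu>) (\<nu> - 1) z s * exp (\<mu> * log3 \<gamma> z) *
     vector_derivative (curve \<gamma>) (at s) / (2 * of_real pi * \<i>)"

definition K ::
  "branched_contour \<Rightarrow> complex \<Rightarrow> complex \<Rightarrow> complex \<Rightarrow> complex \<Rightarrow> complex ^ idx \<Rightarrow> complex" where
  "K \<gamma> \<alpha> \<beta> \<mu> \<nu> z = integral {0<..<1} (kern \<gamma> \<alpha> \<beta> \<mu> \<nu> z)"

definition K_converges ::
  "(complex ^ idx) set \<Rightarrow> branched_contour \<Rightarrow>
   complex \<Rightarrow> complex \<Rightarrow> complex \<Rightarrow> complex \<Rightarrow> bool" where
  "K_converges U \<gamma> \<alpha> \<beta> \<mu> \<nu> \<longleftrightarrow>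
     (\<forall>z\<in>U. kern \<gamma> \<alpha> \<beta> \<mu> \<nu> z absolutely_integrable_on {0<..<1})"

definition diff_under_integral ::
  "(complex ^ idx) set \<Rightarrow> (complex ^ idx \<Rightarrow> real \<Rightarrow> complex) \<Rightarrow> bool" where
  "diff_under_integral U f \<longleftrightarrow>
     (\<forall>z\<in>U. \<forall>i.
        (\<lambda>s. pd i (\<lambda>z. f z s) z) absolutely_integrable_on {0<..<1} \<and>
        ((\<lambda>w. integral {0<..<1} (f (upd z i w))) has_field_derivative
           integral {0<..<1} (\<lambda>s. pd i (\<lambda>z. f z s) z)) (at (z $ i)))"

end

theory Submission
  imports Defs
begin

text \<open>
  All relations but two hold pointwise for the integrands. The two exceptions, for \<open>B\<^sub>1\<^sub>,\<^sub>2\<close> and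
  \<open>B\<^sub>-\<^sub>1\<^sub>,\<^sub>-\<^sub>2\<close>, hold up to the \<open>\<tau>\<close>-derivative of
  \<open>H\<^sub>e = (z\<^sub>1 - \<tau>\<^sup>-\<^sup>1 z\<^sub>-\<^sub>2)\<^sup>\<alpha>\<^sup>+\<^sup>\<nu> (z\<^sub>2 + \<tau>\<^sup>-\<^sup>1 z\<^sub>-\<^sub>1)\<^sup>\<beta>\<^sup>+\<^sup>\<nu> \<tau>\<^sup>e\<close> with \<open>e = \<nu> + 1\<close> and \<open>e = \<nu> - 1\<close>.

  The boundary conditions concern \<open>e = \<nu> - 1\<close> and \<open>e = \<nu>\<close> only, so the case \<open>e = \<nu> + 1\<close> has to be
  derived. Its derivative being integrable, \<open>H\<^sub>\<nu>\<^sub>+\<^sub>1\<close> has limits at both ends. As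
  \<open>H\<^sub>\<nu>\<^sub>+\<^sub>1 H\<^sub>\<nu>\<^sub>-\<^sub>1 = H\<^sub>\<nu>\<^sup>2\<close>, they agree if the common limit of \<open>H\<^sub>\<nu>\<^sub>-\<^sub>1\<close> is nonzero. Otherwise both vanish:
  if \<open>H\<^sub>\<nu>\<^sub>+\<^sub>1\<close> had a nonzero limit at one end, then absolute convergence of \<open>\<integral> H\<^sub>\<nu>\<^sub>+\<^sub>1 d\<tau>/\<tau>\<close>, which is
  \<open>K\<^sub>\<alpha>\<^sub>-\<^sub>1\<^sub>,\<^sub>\<beta>\<^sub>-\<^sub>1\<^sub>,\<^sub>\<mu>\<^sub>,\<^sub>\<nu>\<^sub>+\<^sub>1\<close> up to a factor, would make \<open>d\<tau>/\<tau>\<close> integrable near that end, so \<open>\<tau>\<close> would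
  converge there and \<open>H\<^sub>\<nu>\<^sub>+\<^sub>1 = \<tau>\<^sup>2 H\<^sub>\<nu>\<^sub>-\<^sub>1\<close> would tend to zero.
\<close>

section \<open>Continuous logarithms\<close>

text \<open>Near \<open>x\<close> the values of \<open>L\<close> differ from \<open>L x\<close> by
  less than pi, so there \<open>L y = L x + Ln (A y / A x)\<close> with the principal branch near 1,
  and the chain rule applies. The domain is a general normed space, to cover both a complex
  coordinate and the real curve parameter.\<close>

lemma has_derivative_continuous_log:
  fixes L :: "'a::real_normed_vector \<Rightarrow> complex"
  assumes "isCont L x" and "eventually (\<lambda>y. exp (L y) = A y) (nhds x)"
    and "(A has_derivative A') (at x)"
  shows "(L has_derivative (\<lambda>v. A' v / A x)) (at x)"
proof -
  have Ax: "exp (L x) = A x"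
    using assms(2) by (rule eventually_nhds_x_imp_x)
  hence nz: "A x \<noteq> 0"
    by (metis exp_not_eq_zero)
  have "((\<lambda>y. A y / A x) has_derivative (\<lambda>v. A' v / A x)) (at x)"
    using nz by (auto intro!: derivative_eq_intros assms(3))
  moreover have "(Ln has_derivative (*) 1) (at (A x / A x))"
    using nz has_field_derivative_Ln[of 1] by (simp add: has_field_derivative_def)
  ultimately have "((\<lambda>y. Ln (A y / A x)) has_derivative (\<lambda>v. A' v / A x)) (at x)"
    using has_derivative_compose by fastforce
  hence "((\<lambda>y. L x + Ln (A y / A x)) has_derivative (\<lambda>v. A' v / A x)) (at x)"
    by (rule has_derivative_add[OF has_derivative_const, THEN has_derivative_eq_rhs]) simp
  moreover have "eventually (\<lambda>y. L y = L x + Ln (A y / A x)) (at x)"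
  proof -
    have "eventually (\<lambda>y. dist (L y) (L x) < pi) (at x)"
      using assms(1) pi_gt_zero unfolding isCont_def tendsto_iff by blast
    moreover have "eventually (\<lambda>y. exp (L y) = A y) (at x)"
      using assms(2) by (simp add: eventually_nhds_conv_at)
    ultimately show ?thesis
    proof eventually_elim
      case (elim y)
      have "\<bar>Im (L y - L x)\<bar> < pi"
        using elim(1) abs_Im_le_cmod[of "L y - L x"] by (simp add: dist_norm)
      hence "Ln (exp (L y - L x)) = L y - L x"
        by (intro Ln_exp) auto
      thus ?case
        using elim(2) Ax by (simp add: exp_diff)
    qed
  qed
  ultimately show ?thesis
    using Ax nz
    by (elim has_derivative_transform_eventually) (auto elim: eventually_mono)
qed

section \<open>Integrals and limits at the ends of an open interval\<close>

text \<open>The indefinite integral \<open>P\<close> of \<open>f'\<close> is continuous on the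
  closed interval, and \<open>f - P\<close> is constant inside. Hence integrability of
  \<open>f'\<close> alone forces \<open>f\<close> to converge at both ends.\<close>

lemma fundamental_theorem_of_calculus_open_interval:
  fixes f :: "real \<Rightarrow> 'a::banach"
  assumes "a < b" "continuous_on {a<..<b} f" "finite S"
    and deriv: "\<And>x. x \<in> {a<..<b} - S \<Longrightarrow> (f has_vector_derivative f' x) (at x)"
    and int: "f' integrable_on {a<..<b}"
  obtains l m where "(f \<longlongrightarrow> l) (at_right a)" "(f \<longlongrightarrow> m) (at_left b)"
    "integral {a<..<b} f' = m - l"
proof -
  have int': "f' integrable_on {a..b}"
    using int by (simp add: integrable_on_open_interval_real)
  define P where "P = (\<lambda>x. integral {a..x} f')"
  have P: "continuous_on {a..b} P"
    unfolding P_def using int' by (rule indefinite_integral_continuous_1)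
  have step: "f y - P y = f x - P x" if "a < x" "x \<le> y" "y < b" for x y
  proof -
    have "(f' has_integral (f y - f x)) {x..y}"
      using that assms
      by (intro fundamental_theorem_of_calculus_interior_strong[where S = S])
         (auto intro: continuous_on_subset)
    moreover have "integral {a..x} f' + integral {x..y} f' = integral {a..y} f'"
      using that by (intro Henstock_Kurzweil_Integration.integral_combine
          integrable_subinterval_real[OF int']) auto
    ultimately show ?thesis
      unfolding P_def by (simp add: integral_unique algebra_simps)
  qed
  \<comment> \<open>The midpoint serves as an interior base point at which the constant value of
    \<open>f - P\<close> is read off.\<close>
  define c where "c = (a + b) / 2"
  define k where "k = f c - P c"
  have f: "f x = k + P x" if "x \<in> {a<..<b}" for x
    using step[of x c] step[of c x] that \<open>a < b\<close> unfolding k_def c_def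
    by (cases "x \<le> c") (auto simp: algebra_simps c_def)
  have "((\<lambda>x. k + P x) \<longlongrightarrow> k + P a) (at_right a)" "((\<lambda>x. k + P x) \<longlongrightarrow> k + P b) (at_left b)"
    using P \<open>a < b\<close> continuous_on_Icc_at_rightD[OF P] continuous_on_Icc_at_leftD[OF P]
    by (auto intro!: tendsto_intros)
  moreover have "eventually (\<lambda>x. f x = k + P x) (at_right a)" "eventually (\<lambda>x. f x = k + P x) (at_left b)"
    using f \<open>a < b\<close> by (auto intro!: eventually_at_rightI[of a b] eventually_at_leftI[of a b])
  ultimately have "(f \<longlongrightarrow> k + P a) (at_right a)" "(f \<longlongrightarrow> k + P b) (at_left b)"
    by (auto simp: tendsto_cong)
  moreover have "integral {a<..<b} f' = (k + P b) - (k + P a)"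
    by (simp add: P_def integral_open_interval_real)
  ultimately show ?thesis
    by (rule that)
qed

text \<open>The lower bound makes \<open>1 / h\<close> bounded and continuity makes it measurable,
  so multiplying the integrable product by it preserves absolute integrability.\<close>

lemma absolutely_integrable_cancel_factor:
  fixes h q :: "real \<Rightarrow> complex"
  assumes "continuous_on {a<..<b} h" "c > 0" "\<And>x. x \<in> {a<..<b} \<Longrightarrow> c \<le> norm (h x)"
    and "(\<lambda>x. h x * q x) absolutely_integrable_on {a<..<b}"
  shows "q absolutely_integrable_on {a<..<b}"
proof -
  have nz: "h x \<noteq> 0" if "x \<in> {a<..<b}" for x
    using assms(2,3) that by fastforce
  have "(\<lambda>x. inverse (h x) * (h x * q x)) absolutely_integrable_on {a<..<b}"
  proof (rule absolutely_integrable_bounded_measurable_product[OF bilinear_times])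
    show "(\<lambda>x. inverse (h x)) \<in> borel_measurable (lebesgue_on {a<..<b})"
      using assms(1) nz
      by (intro continuous_imp_measurable_on_sets_lebesgue continuous_on_inverse) auto
    have "norm (inverse (h x)) \<le> inverse c" if "x \<in> {a<..<b}" for x
      using assms(2,3) that by (auto simp: norm_inverse intro: le_imp_inverse_le)
    thus "bounded ((\<lambda>x. inverse (h x)) ` {a<..<b})"
      unfolding bounded_iff by blast
  qed (use assms in auto)
  thus ?thesis
    by (rule absolutely_integrable_spike[OF _ negligible_empty]) (use nz in auto)
qed

text \<open>Near an end where \<open>h\<close> has a nonzero limit, \<open>h\<close> stays away from
  zero, so \<open>q\<close> itself is integrable there and its primitive \<open>L\<close> has a
  limit. In the application \<open>L\<close> is the logarithm of \<tau> and \<open>q\<close> is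
  \<tau>'/\<tau>.\<close>

lemma primitive_converges:
  fixes h q L :: "real \<Rightarrow> complex"
  assumes "a < b" "continuous_on {a<..<b} h" "continuous_on {a<..<b} L" "finite S"
    and deriv: "\<And>x. x \<in> {a<..<b} - S \<Longrightarrow> (L has_vector_derivative q x) (at x)"
    and int: "(\<lambda>x. h x * q x) absolutely_integrable_on {a<..<b}"
    and "l \<noteq> 0"
  shows "(h \<longlongrightarrow> l) (at_right a) \<Longrightarrow> \<exists>m. (L \<longlongrightarrow> m) (at_right a)"
    and "(h \<longlongrightarrow> l) (at_left b) \<Longrightarrow> \<exists>m. (L \<longlongrightarrow> m) (at_left b)"
proof -
  have far: "eventually (\<lambda>x. norm l / 2 < norm (h x)) F" if "(h \<longlongrightarrow> l) F" for F
    using tendsto_norm[OF that] \<open>l \<noteq> 0\<close> by (intro order_tendstoD) auto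
  have sub: "q integrable_on {c<..<d}"
    if "a \<le> c" "d \<le> b" "\<And>x. x \<in> {c<..<d} \<Longrightarrow> norm l / 2 < norm (h x)" for c d
  proof -
    have cd: "{c<..<d} \<subseteq> {a<..<b}"
      using that(1,2) by auto
    have "(\<lambda>x. h x * q x) absolutely_integrable_on {c<..<d}"
      by (rule set_integrable_subset[OF int _ cd]) simp
    moreover have "continuous_on {c<..<d} h"
      by (rule continuous_on_subset[OF assms(2) cd])
    moreover have "norm l / 2 > 0"
      using \<open>l \<noteq> 0\<close> by simp
    ultimately have "q absolutely_integrable_on {c<..<d}"
      using absolutely_integrable_cancel_factor less_imp_le[OF that(3)] by blast
    thus ?thesis
      by (rule set_lebesgue_integral_eq_integral(1))
  qed
  {
    assume "(h \<longlongrightarrow> l) (at_right a)"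
    from far[OF this] obtain d where "d > a" "\<And>x. a < x \<Longrightarrow> x < d \<Longrightarrow> norm l / 2 < norm (h x)"
      unfolding eventually_at_right_field by blast
    hence q: "q integrable_on {a<..<min b d}"
      by (intro sub) auto
    show "\<exists>m. (L \<longlongrightarrow> m) (at_right a)"
      by (rule fundamental_theorem_of_calculus_open_interval[OF _ _ \<open>finite S\<close> _ q, of L])
         (use \<open>a < b\<close> \<open>d > a\<close> in \<open>auto intro!: deriv continuous_on_subset[OF assms(3)]\<close>)
  next
    assume "(h \<longlongrightarrow> l) (at_left b)"
    from far[OF this] obtain d where "d < b" "\<And>x. d < x \<Longrightarrow> x < b \<Longrightarrow> norm l / 2 < norm (h x)"
      unfolding eventually_at_left_field by blast
    hence q: "q integrable_on {max a d<..<b}"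
      by (intro sub) auto
    show "\<exists>m. (L \<longlongrightarrow> m) (at_left b)"
      by (rule fundamental_theorem_of_calculus_open_interval[OF _ _ \<open>finite S\<close> _ q, of L])
         (use \<open>a < b\<close> \<open>d < b\<close> in \<open>auto intro!: deriv continuous_on_subset[OF assms(3)]\<close>)
  }
qed

section \<open>Derivatives along coordinate slices and along the curve\<close>

lemma upd_nth [simp]: "upd z i w $ k = (if k = i then w else z $ k)"
  by (simp add: upd_def)

lemma upd_self [simp]: "upd z i (z $ i) = z"
  by (simp add: vec_eq_iff)

lemma upd_has_field_derivative:
  "((\<lambda>w. upd z i w $ k) has_field_derivative (if k = i then 1 else 0)) (at x)"
  by (cases "k = i") simp_all

lemma continuous_upd: "isCont (upd z i) x"
  unfolding isCont_def by (rule vec_tendstoI) (auto intro!: tendsto_intros)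

text \<open>Holomorphy supplies continuity on the slice, and \<open>exp L = A\<close> then fixes the
  derivative as that of a logarithm.\<close>

lemma log_slice_has_field_derivative:
  fixes L A :: "complex ^ idx \<Rightarrow> complex"
  assumes "open U" "z \<in> U" "holo_on L U" "\<And>y. y \<in> U \<Longrightarrow> exp (L y) = A y"
    and "((\<lambda>w. A (upd z i w)) has_field_derivative d) (at (z $ i))"
  shows "((\<lambda>w. L (upd z i w)) has_field_derivative d / A z) (at (z $ i))"
proof -
  have "isCont L z"
    using assms(2,3) unfolding holo_on_def by (meson has_derivative_continuous)
  hence "isCont (\<lambda>w. L (upd z i w)) (z $ i)"
    by (simp add: isCont_o2[where g = L, OF continuous_upd])
  moreover have "eventually (\<lambda>w. upd z i w \<in> U) (nhds (z $ i))"
    using continuous_upd[of "z $ i" z i] assms(1,2)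
    unfolding isCont_def eventually_nhds_conv_at
    by (auto dest: topological_tendstoD)
  hence "eventually (\<lambda>w. exp (L (upd z i w)) = A (upd z i w)) (nhds (z $ i))"
    by (rule eventually_mono) (rule assms(4))
  moreover note assms(5)
  ultimately show ?thesis
    unfolding has_field_derivative_def
    by (rule has_derivative_eq_rhs[OF has_derivative_continuous_log]) (auto simp: field_simps)
qed

text \<open>The counterpart in the curve parameter; it serves for \<tau> and for both linear
  factors.\<close>

lemma log_curve_has_vector_derivative:
  fixes L A :: "real \<Rightarrow> complex"
  assumes "continuous_on {0<..<1} L" "\<And>s. s \<in> {0<..<1} \<Longrightarrow> exp (L s) = A s" "s \<in> {0<..<1}"
    and "(A has_vector_derivative d) (at s)"
  shows "(L has_vector_derivative d / A s) (at s)"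
proof -
  have "isCont L s"
    using assms(1,3) by (simp add: continuous_on_eq_continuous_at)
  moreover have "eventually (\<lambda>s. s \<in> {0<..<1}) (nhds s)"
    using assms(3) by (intro eventually_nhds_in_open) auto
  hence "eventually (\<lambda>s. exp (L s) = A s) (nhds s)"
    by (rule eventually_mono) (rule assms(2))
  moreover note assms(4)
  ultimately show ?thesis
    unfolding has_vector_derivative_def
    by (rule has_derivative_eq_rhs[OF has_derivative_continuous_log]) (auto simp: scaleR_conv_of_real)
qed

section \<open>Logarithmic derivatives of the integrand\<close>

text \<open>Kept folded, like \<open>fac2\<close>, so that \<open>field_simps\<close> sees the bases
  as nonzero atoms.\<close>

definition fac1 :: "branched_contour \<Rightarrow> complex ^ idx \<Rightarrow> real \<Rightarrow> complex" where
  "fac1 \<gamma> z s = z $ P1 - inverse (curve \<gamma> s) * z $ M2"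

definition fac2 :: "branched_contour \<Rightarrow> complex ^ idx \<Rightarrow> real \<Rightarrow> complex" where
  "fac2 \<gamma> z s = z $ P2 + inverse (curve \<gamma> s) * z $ M1"

lemma admissibleD:
  assumes "admissible U \<gamma>" "z \<in> U" "s \<in> {0<..<1}"
  shows "exp (log1 \<gamma> z s) = fac1 \<gamma> z s" "exp (log2 \<gamma> z s) = fac2 \<gamma> z s"
    "exp (log_curve \<gamma> s) = curve \<gamma> s" "exp (log3 \<gamma> z) = z $ P3"
    "fac1 \<gamma> z s \<noteq> 0" "fac2 \<gamma> z s \<noteq> 0" "curve \<gamma> s \<noteq> 0" "z $ P3 \<noteq> 0"
proof -
  show *: "exp (log1 \<gamma> z s) = fac1 \<gamma> z s" "exp (log2 \<gamma> z s) = fac2 \<gamma> z s"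
    "exp (log_curve \<gamma> s) = curve \<gamma> s" "exp (log3 \<gamma> z) = z $ P3"
    using assms unfolding admissible_def log_branch_def fac1_def fac2_def by auto
  show "fac1 \<gamma> z s \<noteq> 0" "fac2 \<gamma> z s \<noteq> 0" "curve \<gamma> s \<noteq> 0" "z $ P3 \<noteq> 0"
    unfolding *[symmetric] by auto
qed

text \<open>Each factor that varies with z is the exponential of a multiple of a logarithm, so the
  derivative is the integrand times a logarithmic derivative. The Kronecker delta treats all six
  coordinates at once; for \<open>M3\<close> every term vanishes.\<close>

lemma pd_kern:
  assumes "open U" "admissible U \<gamma>" "z \<in> U" "s \<in> {0<..<1}"
  defines "\<delta> \<equiv> \<lambda>j i :: idx. if j = i then 1 else 0 :: complex"
  shows "pd i (\<lambda>z. kern \<gamma> \<alpha> \<beta> \<mu> \<nu> z s) z =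
    ((\<alpha> + \<nu>) * ((\<delta> P1 i - inverse (curve \<gamma> s) * \<delta> M2 i) / fac1 \<gamma> z s) +
     (\<beta> + \<nu>) * ((\<delta> P2 i + inverse (curve \<gamma> s) * \<delta> M1 i) / fac2 \<gamma> z s) +
     \<mu> * (\<delta> P3 i / z $ P3)) * kern \<gamma> \<alpha> \<beta> \<mu> \<nu> z s"
proof -
  note slice = log_slice_has_field_derivative[OF assms(1,3), where i = i]
  note D = admissibleD[OF assms(2) _ assms(4)]
  have holo: "holo_on (\<lambda>z. log1 \<gamma> z s) U" "holo_on (\<lambda>z. log2 \<gamma> z s) U" "holo_on (log3 \<gamma>) U"
    using assms(2,4) unfolding admissible_def log_branch_def by auto
  have \<delta>: "((\<lambda>w. upd z i w $ k) has_field_derivative \<delta> k i) (at x)" for k x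
    unfolding \<delta>_def by (rule upd_has_field_derivative)
  have "((\<lambda>w. log1 \<gamma> (upd z i w) s) has_field_derivative
      (\<delta> P1 i - inverse (curve \<gamma> s) * \<delta> M2 i) / fac1 \<gamma> z s) (at (z $ i))"
    unfolding fac1_def
    by (rule slice[OF holo(1) D(1)[unfolded fac1_def]], assumption,
        rule DERIV_diff[OF \<delta> DERIV_cmult[OF \<delta>]])
  moreover have "((\<lambda>w. log2 \<gamma> (upd z i w) s) has_field_derivative
      (\<delta> P2 i + inverse (curve \<gamma> s) * \<delta> M1 i) / fac2 \<gamma> z s) (at (z $ i))"
    unfolding fac2_def
    by (rule slice[OF holo(2) D(2)[unfolded fac2_def]], assumption,
        rule DERIV_add[OF \<delta> DERIV_cmult[OF \<delta>]])
  moreover have "((\<lambda>w. log3 \<gamma> (upd z i w)) has_field_derivative \<delta> P3 i / z $ P3) (at (z $ i))"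
    by (rule slice[OF holo(3) D(4) \<delta>])
  \<comment> \<open>Here \<open>c1\<close>, \<open>c2\<close>, \<open>c3\<close> stand for the
    factors free of the coordinate: the power of \<tau>, the velocity \<tau>' and 2 pi i.\<close>
  moreover have "((\<lambda>w. exp (a * f1 w) * exp (b * f2 w) * c1 * exp (\<mu> * f3 w) * c2 / c3) has_field_derivative
      (a * d1 + b * d2 + \<mu> * d3) * (exp (a * f1 x) * exp (b * f2 x) * c1 * exp (\<mu> * f3 x) * c2 / c3)) (at x)"
    if "(f1 has_field_derivative d1) (at x)" "(f2 has_field_derivative d2) (at x)"
      "(f3 has_field_derivative d3) (at x)" for f1 f2 f3 a b c1 c2 c3 d1 d2 d3 x
    using that by (auto intro!: derivative_eq_intros simp: algebra_simps divide_inverse)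
  ultimately have "((\<lambda>w. kern \<gamma> \<alpha> \<beta> \<mu> \<nu> (upd z i w) s) has_field_derivative
    ((\<alpha> + \<nu>) * ((\<delta> P1 i - inverse (curve \<gamma> s) * \<delta> M2 i) / fac1 \<gamma> z s) +
     (\<beta> + \<nu>) * ((\<delta> P2 i + inverse (curve \<gamma> s) * \<delta> M1 i) / fac2 \<gamma> z s) +
     \<mu> * (\<delta> P3 i / z $ P3)) *
    kern \<gamma> \<alpha> \<beta> \<mu> \<nu> (upd z i (z $ i)) s) (at (z $ i))"
    unfolding kern_def pw_def by blast
  thus ?thesis
    unfolding pd_def by (auto dest: DERIV_imp_deriv)
qed

lemma pw_eq_exp:
  "pw \<gamma> a b c z s = exp (a * log1 \<gamma> z s + b * log2 \<gamma> z s + c * log_curve \<gamma> s)"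
  by (simp add: pw_def exp_add)

lemma continuous_on_pw:
  assumes "admissible U \<gamma>" "z \<in> U"
  shows "continuous_on {0<..<1} (pw \<gamma> a b c z)"
  using assms unfolding pw_eq_exp admissible_def log_branch_def
  by (auto intro!: continuous_intros)

lemma log_curve_deriv:
  assumes "admissible U \<gamma>" "s \<in> {0<..<1}" "(curve \<gamma> has_vector_derivative d) (at s)"
  shows "(log_curve \<gamma> has_vector_derivative d / curve \<gamma> s) (at s)"
  by (rule log_curve_has_vector_derivative)
     (use assms in \<open>auto simp: admissible_def\<close>)

text \<open>The inverse of \<tau> has derivative -\<tau>'/\<tau>^2 and enters the two linear factors
  with opposite signs, whence the signs of the terms in \<open>a\<close> and
  \<open>b\<close>.\<close>

lemma pw_has_vector_derivative:
  assumes "admissible U \<gamma>" "z \<in> U" "s \<in> {0<..<1}" "(curve \<gamma> has_vector_derivative d) (at s)"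
  shows "(pw \<gamma> a b c z has_vector_derivative
    pw \<gamma> a b c z s * d * (a * (z $ M2 / curve \<gamma> s ^ 2 / fac1 \<gamma> z s)
      - b * (z $ M1 / curve \<gamma> s ^ 2 / fac2 \<gamma> z s) + c / curve \<gamma> s)) (at s)"
proof -
  note D = admissibleD[OF assms(1,2)]
  have inv: "((\<lambda>t. inverse (curve \<gamma> t)) has_vector_derivative - d / curve \<gamma> s ^ 2) (at s)"
    using field_vector_diff_chain_at[OF assms(4), of inverse "- inverse (curve \<gamma> s ^ 2)"]
      DERIV_inverse[OF D(7)[OF assms(3)]]
    by (simp add: o_def divide_inverse power2_eq_square)
  have "(log1 \<gamma> z has_vector_derivative (z $ M2 * d / curve \<gamma> s ^ 2) / fac1 \<gamma> z s) (at s)"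
  proof (rule log_curve_has_vector_derivative[OF _ D(1) assms(3)])
    show "(fac1 \<gamma> z has_vector_derivative z $ M2 * d / curve \<gamma> s ^ 2) (at s)"
      unfolding fac1_def by (auto intro!: derivative_eq_intros inv)
  qed (use assms in \<open>auto simp: admissible_def log_branch_def\<close>)
  moreover have "(log2 \<gamma> z has_vector_derivative (- z $ M1 * d / curve \<gamma> s ^ 2) / fac2 \<gamma> z s) (at s)"
  proof (rule log_curve_has_vector_derivative[OF _ D(2) assms(3)])
    show "(fac2 \<gamma> z has_vector_derivative - z $ M1 * d / curve \<gamma> s ^ 2) (at s)"
      unfolding fac2_def by (auto intro!: derivative_eq_intros inv)
  qed (use assms in \<open>auto simp: admissible_def log_branch_def\<close>)
  ultimately have "((\<lambda>s. a * log1 \<gamma> z s + b * log2 \<gamma> z s + c * log_curve \<gamma> s) has_vector_derivative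
      a * ((z $ M2 * d / curve \<gamma> s ^ 2) / fac1 \<gamma> z s)
      + b * ((- z $ M1 * d / curve \<gamma> s ^ 2) / fac2 \<gamma> z s) + c * (d / curve \<gamma> s)) (at s)"
    using log_curve_deriv[OF assms(1,3,4)]
    by (intro has_vector_derivative_add has_vector_derivative_mult_right)
  from field_vector_diff_chain_at[OF this DERIV_exp] show ?thesis
    unfolding pw_eq_exp o_def by (rule has_vector_derivative_eq_rhs) (simp add: algebra_simps)
qed

section \<open>The boundary condition for the exponent \<nu> + 1\<close>

text \<open>Applied with \<open>g\<close> the product of powers with \<tau>-exponent \<nu> - 1,
  \<open>exp L\<close> equal to \<tau> and \<open>q\<close> equal to \<tau>'/\<tau>. The
  integrability hypothesis rules out a nonzero limit when \<open>g\<close> tends to 0.\<close>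

lemma boundary_vanishes_square:
  fixes g L q :: "real \<Rightarrow> complex"
  assumes "continuous_on {0<..<1} g" "continuous_on {0<..<1} L" "finite S"
    and "\<And>s. s \<in> {0<..<1} - S \<Longrightarrow> (L has_vector_derivative q s) (at s)"
    and "boundary_vanishes g" "boundary_vanishes (\<lambda>s. g s * exp (L s))"
    and int: "(\<lambda>s. (g s * exp (L s) ^ 2) * q s) absolutely_integrable_on {0<..<1}"
    and l: "((\<lambda>s. g s * exp (L s) ^ 2) \<longlongrightarrow> l) (at_right 0)"
    and m: "((\<lambda>s. g s * exp (L s) ^ 2) \<longlongrightarrow> m) (at_left 1)"
  shows "l = m"
proof -
  let ?h = "\<lambda>s. g s * exp (L s) ^ 2"
  obtain g0 f0 where g0: "(g \<longlongrightarrow> g0) (at_right 0)" "(g \<longlongrightarrow> g0) (at_left 1)"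
    and f0: "((\<lambda>s. g s * exp (L s)) \<longlongrightarrow> f0) (at_right 0)"
      "((\<lambda>s. g s * exp (L s)) \<longlongrightarrow> f0) (at_left 1)"
    using assms(5,6) unfolding boundary_vanishes_def by auto
  \<comment> \<open>At either end the product of the outer two functions is the square of the middle
    one; if \<open>g0\<close> is nonzero, this determines the limit \<open>x\<close>.\<close>
  have sq: "x * g0 = f0 ^ 2"
    if "F \<noteq> bot" "(?h \<longlongrightarrow> x) F" "(g \<longlongrightarrow> g0) F" "((\<lambda>s. g s * exp (L s)) \<longlongrightarrow> f0) F" for x F
  proof (rule tendsto_unique[OF that(1)])
    show "((\<lambda>s. ?h s * g s) \<longlongrightarrow> x * g0) F"
      by (intro tendsto_intros that)
    have "((\<lambda>s. (g s * exp (L s)) ^ 2) \<longlongrightarrow> f0 ^ 2) F"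
      by (intro tendsto_intros that)
    thus "((\<lambda>s. ?h s * g s) \<longlongrightarrow> f0 ^ 2) F"
      by (simp add: power2_eq_square mult_ac)
  qed
  \<comment> \<open>If \<open>x\<close> were nonzero, \<open>L\<close> and hence
    \<open>exp L\<close> would converge, and the factor \<open>g\<close> would force the limit
    0.\<close>
  have zero: "x = 0"
    if F: "F \<noteq> bot" "(?h \<longlongrightarrow> x) F" "(g \<longlongrightarrow> g0) F" "g0 = 0" "x \<noteq> 0 \<Longrightarrow> \<exists>t. (L \<longlongrightarrow> t) F" for x F
  proof (rule ccontr)
    assume "x \<noteq> 0"
    then obtain t where t: "(L \<longlongrightarrow> t) F"
      using F(5) by blast
    have "(?h \<longlongrightarrow> g0 * exp t ^ 2) F"
      by (intro tendsto_intros F t)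
    thus False
      using tendsto_unique[OF F(1) _ F(2)] \<open>x \<noteq> 0\<close> \<open>g0 = 0\<close> by fastforce
  qed
  have cont: "continuous_on {0<..<1} ?h"
    using assms(1,2) by (intro continuous_intros)
  note conv = primitive_converges[OF zero_less_one cont assms(2,3,4) int]
  show ?thesis
  proof (cases "g0 = 0")
    case True
    have "l = 0"
      by (rule zero[OF _ l g0(1) True]) (use conv(1) l in auto)
    moreover have "m = 0"
      by (rule zero[OF _ m g0(2) True]) (use conv(2) m in auto)
    ultimately show ?thesis
      by simp
  next
    case False
    moreover have "l * g0 = f0 ^ 2" "m * g0 = f0 ^ 2"
      using sq[OF _ l g0(1) f0(1)] sq[OF _ m g0(2) f0(2)] by auto
    ultimately show ?thesis
      by (metis mult_cancel_right)
  qed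
qed

section \<open>Parameter shifts and passage under the integral\<close>

lemma pw_shift: "pw \<gamma> a b (c + e) z s = pw \<gamma> a b c z s * exp (e * log_curve \<gamma> s)"
  by (simp add: pw_def distrib_right exp_add)

text \<open>The exponents of the two factors and of \<tau> are \<alpha> + \<nu>, \<beta> + \<nu> and
  \<nu> - 1, so a change of \<nu> moves all three unless \<alpha> or \<beta> compensates. As the
  branches stay the same, each shift multiplies the integrand by a Laurent monomial in the factors,
  \<tau> and z_3.\<close>

lemma kern_shift:
  fixes \<alpha> \<beta> \<mu> \<nu> :: complex
  assumes "admissible U \<gamma>" "z \<in> U" "s \<in> {0<..<1}"
  defines "k \<equiv> kern \<gamma> \<alpha> \<beta> \<mu> \<nu> z s"
  shows "kern \<gamma> (\<alpha> + 1) (\<beta> - 1) \<mu> \<nu> z s = k * fac1 \<gamma> z s / fac2 \<gamma> z s"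
    and "kern \<gamma> (\<alpha> - 1) (\<beta> + 1) \<mu> \<nu> z s = k * fac2 \<gamma> z s / fac1 \<gamma> z s"
    and "kern \<gamma> (\<alpha> - 1) (\<beta> - 1) \<mu> (\<nu> + 1) z s = k * curve \<gamma> s"
    and "kern \<gamma> (\<alpha> + 1) (\<beta> + 1) \<mu> (\<nu> - 1) z s = k / curve \<gamma> s"
    and "kern \<gamma> (\<alpha> - 1) \<beta> (\<mu> + 1) \<nu> z s = k * z $ P3 / fac1 \<gamma> z s"
    and "kern \<gamma> (\<alpha> + 1) \<beta> (\<mu> + 1) (\<nu> - 1) z s = k * z $ P3 / (fac2 \<gamma> z s * curve \<gamma> s)"
    and "kern \<gamma> \<alpha> (\<beta> - 1) (\<mu> + 1) \<nu> z s = k * z $ P3 / fac2 \<gamma> z s"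
    and "kern \<gamma> \<alpha> (\<beta> + 1) (\<mu> + 1) (\<nu> - 1) z s = k * z $ P3 / (fac1 \<gamma> z s * curve \<gamma> s)"
proof -
  \<comment> \<open>Lowering \<nu> gives \<tau> the exponent \<nu> - 2, which produces the
    exponential of a doubled logarithm.\<close>
  have "exp (x * 2) = exp x * exp x" for x :: complex
    by (metis exp_add mult_2_right)
  thus "kern \<gamma> (\<alpha> + 1) (\<beta> - 1) \<mu> \<nu> z s = k * fac1 \<gamma> z s / fac2 \<gamma> z s"
    "kern \<gamma> (\<alpha> - 1) (\<beta> + 1) \<mu> \<nu> z s = k * fac2 \<gamma> z s / fac1 \<gamma> z s"
    "kern \<gamma> (\<alpha> - 1) (\<beta> - 1) \<mu> (\<nu> + 1) z s = k * curve \<gamma> s"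
    "kern \<gamma> (\<alpha> + 1) (\<beta> + 1) \<mu> (\<nu> - 1) z s = k / curve \<gamma> s"
    "kern \<gamma> (\<alpha> - 1) \<beta> (\<mu> + 1) \<nu> z s = k * z $ P3 / fac1 \<gamma> z s"
    "kern \<gamma> (\<alpha> + 1) \<beta> (\<mu> + 1) (\<nu> - 1) z s = k * z $ P3 / (fac2 \<gamma> z s * curve \<gamma> s)"
    "kern \<gamma> \<alpha> (\<beta> - 1) (\<mu> + 1) \<nu> z s = k * z $ P3 / fac2 \<gamma> z s"
    "kern \<gamma> \<alpha> (\<beta> + 1) (\<mu> + 1) (\<nu> - 1) z s = k * z $ P3 / (fac1 \<gamma> z s * curve \<gamma> s)"
    unfolding k_def kern_def pw_def admissibleD(1-4)[OF assms(1-3), symmetric]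
    by (simp_all add: algebra_simps exp_add exp_diff exp_minus)
qed

text \<open>The coefficients of \<open>B\<close> are constant in s, so differentiation under the
  integral sign lets \<open>B\<close> act on the integrand. Integrability of the result is recorded
  because integrals will be subtracted.\<close>

lemma B_K:
  fixes \<alpha> \<beta> \<mu> \<nu> :: complex
  assumes "diff_under_integral U (kern \<gamma> \<alpha> \<beta> \<mu> \<nu>)" "z \<in> U"
  defines "b \<equiv> \<lambda>i j s. z $ (- i) * pd j (\<lambda>z. kern \<gamma> \<alpha> \<beta> \<mu> \<nu> z s) z
    - z $ (- j) * pd i (\<lambda>z. kern \<gamma> \<alpha> \<beta> \<mu> \<nu> z s) z"
  shows "b i j absolutely_integrable_on {0<..<1}"
    and "B i j (K \<gamma> \<alpha> \<beta> \<mu> \<nu>) z = integral {0<..<1} (b i j)"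
proof -
  have int: "(\<lambda>s. pd i (\<lambda>z. kern \<gamma> \<alpha> \<beta> \<mu> \<nu> z s) z) absolutely_integrable_on {0<..<1}" for i
    using assms(1,2) unfolding diff_under_integral_def by blast
  have pd: "pd i (K \<gamma> \<alpha> \<beta> \<mu> \<nu>) z = integral {0<..<1} (\<lambda>s. pd i (\<lambda>z. kern \<gamma> \<alpha> \<beta> \<mu> \<nu> z s) z)" for i
    using assms(1,2) unfolding diff_under_integral_def pd_def[of i "K \<gamma> \<alpha> \<beta> \<mu> \<nu>"] K_def
    by (blast intro: DERIV_imp_deriv)
  show "b i j absolutely_integrable_on {0<..<1}"
    unfolding b_def by (intro set_integral_diff(1) set_integrable_mult_right) (use int in auto)
  have "(\<lambda>s. c * pd i (\<lambda>z. kern \<gamma> \<alpha> \<beta> \<mu> \<nu> z s) z) integrable_on {0<..<1}" for c i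
    using set_lebesgue_integral_eq_integral(1)[OF int] by (rule integrable_on_mult_right)
  thus "B i j (K \<gamma> \<alpha> \<beta> \<mu> \<nu>) z = integral {0<..<1} (b i j)"
    unfolding b_def B_def pd by (simp add: Henstock_Kurzweil_Integration.integral_diff)
qed

section \<open>The eight relations\<close>

theorem proposition5p3:
  fixes \<alpha> \<beta> \<mu> \<nu> :: complex
    and U :: "(complex ^ idx) set"
    and \<gamma> :: branched_contour
  assumes "open U"
    and "admissible U \<gamma>"
    and "\<forall>z\<in>U. boundary_vanishes (pw \<gamma> (\<alpha> + \<nu>) (\<beta> + \<nu>) (\<nu> - 1) z)"
    and "\<forall>z\<in>U. boundary_vanishes (pw \<gamma> (\<alpha> + \<nu>) (\<beta> + \<nu>) \<nu> z)"
    and "diff_under_integral U (kern \<gamma> \<alpha> \<beta> \<mu> \<nu>)"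
    and "K_converges U \<gamma> \<alpha> \<beta> \<mu> \<nu>"
    and "K_converges U \<gamma> (\<alpha> + 1) (\<beta> - 1) \<mu> \<nu>"
    and "K_converges U \<gamma> (\<alpha> - 1) (\<beta> + 1) \<mu> \<nu>"
    and "K_converges U \<gamma> (\<alpha> - 1) (\<beta> - 1) \<mu> (\<nu> + 1)"
    and "K_converges U \<gamma> (\<alpha> + 1) (\<beta> + 1) \<mu> (\<nu> - 1)"
    and "K_converges U \<gamma> (\<alpha> - 1) \<beta> (\<mu> + 1) \<nu>"
    and "K_converges U \<gamma> (\<alpha> + 1) \<beta> (\<mu> + 1) (\<nu> - 1)"
    and "K_converges U \<gamma> \<alpha> (\<beta> - 1) (\<mu> + 1) \<nu>"
    and "K_converges U \<gamma> \<alpha> (\<beta> + 1) (\<mu> + 1) (\<nu> - 1)"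
  shows "\<forall>z\<in>U.
      B M1 P2 (K \<gamma> \<alpha> \<beta> \<mu> \<nu>) z = (\<beta> + \<nu>) * K \<gamma> (\<alpha> + 1) (\<beta> - 1) \<mu> \<nu> z \<and>
      B P1 M2 (K \<gamma> \<alpha> \<beta> \<mu> \<nu>) z = - (\<alpha> + \<nu>) * K \<gamma> (\<alpha> - 1) (\<beta> + 1) \<mu> \<nu> z \<and>
      B P1 P2 (K \<gamma> \<alpha> \<beta> \<mu> \<nu>) z = (\<nu> + 1) * K \<gamma> (\<alpha> - 1) (\<beta> - 1) \<mu> (\<nu> + 1) z \<and>
      B M1 M2 (K \<gamma> \<alpha> \<beta> \<mu> \<nu>) z = - (\<alpha> + \<beta> + \<nu> + 1) * K \<gamma> (\<alpha> + 1) (\<beta> + 1) \<mu> (\<nu> - 1) z \<and>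
      B P1 M3 (K \<gamma> \<alpha> \<beta> \<mu> \<nu>) z = - (\<alpha> + \<nu>) * K \<gamma> (\<alpha> - 1) \<beta> (\<mu> + 1) \<nu> z \<and>
      B M1 M3 (K \<gamma> \<alpha> \<beta> \<mu> \<nu>) z = - (\<beta> + \<nu>) * K \<gamma> (\<alpha> + 1) \<beta> (\<mu> + 1) (\<nu> - 1) z \<and>
      B P2 M3 (K \<gamma> \<alpha> \<beta> \<mu> \<nu>) z = - (\<beta> + \<nu>) * K \<gamma> \<alpha> (\<beta> - 1) (\<mu> + 1) \<nu> z \<and>
      B M2 M3 (K \<gamma> \<alpha> \<beta> \<mu> \<nu>) z = (\<alpha> + \<nu>) * K \<gamma> \<alpha> (\<beta> + 1) (\<mu> + 1) (\<nu> - 1) z"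
  (is "\<forall>z\<in>U. ?G z")
proof (intro ballI)
  fix z assume z: "z \<in> U"
  note adm = \<open>admissible U \<gamma>\<close> and diff = \<open>diff_under_integral U (kern \<gamma> \<alpha> \<beta> \<mu> \<nu>)\<close>
  define b where "b = (\<lambda>i j s. z $ (- i) * pd j (\<lambda>z. kern \<gamma> \<alpha> \<beta> \<mu> \<nu> z s) z
    - z $ (- j) * pd i (\<lambda>z. kern \<gamma> \<alpha> \<beta> \<mu> \<nu> z s) z)"
  have B: "b i j absolutely_integrable_on {0<..<1}"
    "B i j (K \<gamma> \<alpha> \<beta> \<mu> \<nu>) z = integral {0<..<1} (b i j)" for i j
    unfolding b_def using B_K[OF diff z] by blast+
  note pds = pd_kern[OF \<open>open U\<close> adm z]
  note shifts = kern_shift[OF adm z]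
  note D = admissibleD[OF adm z]
  have rel: "B i j (K \<gamma> \<alpha> \<beta> \<mu> \<nu>) z = c * K \<gamma> \<alpha>' \<beta>' \<mu>' \<nu>' z"
    if "\<And>s. s \<in> {0<..<1} \<Longrightarrow> b i j s = c * kern \<gamma> \<alpha>' \<beta>' \<mu>' \<nu>' z s" for i j c \<alpha>' \<beta>' \<mu>' \<nu>'
  proof -
    have "B i j (K \<gamma> \<alpha> \<beta> \<mu> \<nu>) z = integral {0<..<1} (\<lambda>s. c * kern \<gamma> \<alpha>' \<beta>' \<mu>' \<nu>' z s)"
      unfolding B(2) by (rule integral_cong) (rule that)
    thus ?thesis
      by (simp add: K_def)
  qed
  \<comment> \<open>These eliminate z_1 and z_2 in favour of the factors, which turns the pointwise
    identities into rational ones that \<open>field_simps\<close> settles.\<close>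
  have fac1': "z $ P1 = fac1 \<gamma> z s + z $ M2 / curve \<gamma> s"
    and fac2': "z $ P2 = fac2 \<gamma> z s - z $ M1 / curve \<gamma> s" for s
    by (simp_all add: fac1_def fac2_def divide_inverse)

  obtain S where S: "finite S" "\<And>s. s \<in> {0<..<1} - S \<Longrightarrow>
      (curve \<gamma> has_vector_derivative vector_derivative (curve \<gamma>) (at s)) (at s)"
    using adm unfolding admissible_def piecewise_C1_differentiable_on_def C1_differentiable_on_eq
    by (metis vector_derivative_works)
  \<comment> \<open>\<open>C\<close> collects the factors of the integrand that are constant in s:
    the integrand is \<open>C\<close> times \<open>h (\<nu> - 1)\<close> times \<tau>'.\<close>
  define C where "C = exp (\<mu> * log3 \<gamma> z) / (2 * of_real pi * \<i>)"
  have [simp]: "C \<noteq> 0"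
    by (simp add: C_def)
  \<comment> \<open>These are the functions \<open>H\<^sub>e\<close> and their derivatives off
    \<open>S\<close>.\<close>
  define h where "h = (\<lambda>e. pw \<gamma> (\<alpha> + \<nu>) (\<beta> + \<nu>) e z)"
  define h' where "h' = (\<lambda>e s. h e s * vector_derivative (curve \<gamma>) (at s) *
      ((\<alpha> + \<nu>) * (z $ M2 / curve \<gamma> s ^ 2 / fac1 \<gamma> z s)
       - (\<beta> + \<nu>) * (z $ M1 / curve \<gamma> s ^ 2 / fac2 \<gamma> z s) + e / curve \<gamma> s))"
  have h': "(h e has_vector_derivative h' e s) (at s)" if "s \<in> {0<..<1} - S" for s e
    unfolding h_def h'_def by (rule pw_has_vector_derivative[OF adm z]) (use that S in auto)
  have cont: "continuous_on {0<..<1} (h e)" for e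
    unfolding h_def by (rule continuous_on_pw[OF adm z])
  have h_eq: "h (\<nu> - 1 + e) s * vector_derivative (curve \<gamma>) (at s) =
      kern \<gamma> \<alpha> \<beta> \<mu> \<nu> z s / C * exp (e * log_curve \<gamma> s)" for e s
    unfolding h_def pw_shift kern_def C_def by simp
  \<comment> \<open>The two integrands differ by \<open>C * h' e\<close>, whose integral is a
    boundary difference. The identity \<open>eq\<close> can be asked for on \<open>S\<close> too,
    since both sides carry the same value of \<open>vector_derivative\<close>.\<close>
  have exceptional: "B i j (K \<gamma> \<alpha> \<beta> \<mu> \<nu>) z = c * K \<gamma> \<alpha>' \<beta>' \<mu>' \<nu>' z"
    if conv: "K_converges U \<gamma> \<alpha>' \<beta>' \<mu>' \<nu>'"
      and eq: "\<And>s. s \<in> {0<..<1} \<Longrightarrow> C * h' e s = c * kern \<gamma> \<alpha>' \<beta>' \<mu>' \<nu>' z s - b i j s"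
      and bdry: "\<And>l m. (h e \<longlongrightarrow> l) (at_right 0) \<Longrightarrow> (h e \<longlongrightarrow> m) (at_left 1) \<Longrightarrow> l = m"
    for i j c \<alpha>' \<beta>' \<mu>' \<nu>' e
  proof -
    let ?k = "kern \<gamma> \<alpha>' \<beta>' \<mu>' \<nu>' z"
    have k: "(\<lambda>s. c * ?k s) integrable_on {0<..<1}"
      using conv z unfolding K_converges_def
      by (intro integrable_on_mult_right set_lebesgue_integral_eq_integral(1)) auto
    have b: "b i j integrable_on {0<..<1}"
      by (intro set_lebesgue_integral_eq_integral(1) B(1))
    have "(\<lambda>s. (c * ?k s - b i j s) / C) integrable_on {0<..<1}"
      by (intro integrable_on_divide Henstock_Kurzweil_Integration.integrable_diff k b)
    \<comment> \<open>Inherited from the two integrands; this makes \<open>h e\<close> converge at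
      both ends, also for the exponent \<nu> + 1.\<close>
    hence int: "h' e integrable_on {0<..<1}"
      by (rule integrable_eq) (simp flip: eq)
    obtain l m where lm: "(h e \<longlongrightarrow> l) (at_right 0)" "(h e \<longlongrightarrow> m) (at_left 1)"
      "integral {0<..<1} (h' e) = m - l"
      by (rule fundamental_theorem_of_calculus_open_interval[OF zero_less_one cont S(1) h' int])
    hence "integral {0<..<1} (\<lambda>s. C * h' e s) = 0"
      using bdry[OF lm(1,2)] by simp
    also have "integral {0<..<1} (\<lambda>s. C * h' e s) = integral {0<..<1} (\<lambda>s. c * ?k s - b i j s)"
      by (rule integral_cong) (rule eq)
    also have "\<dots> = c * K \<gamma> \<alpha>' \<beta>' \<mu>' \<nu>' z - B i j (K \<gamma> \<alpha> \<beta> \<mu> \<nu>) z"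
      using k b by (simp add: Henstock_Kurzweil_Integration.integral_diff B(2) K_def)
    finally show ?thesis
      by simp
  qed

  \<comment> \<open>Relations up to an exact derivative\<close>
  have "B P1 P2 (K \<gamma> \<alpha> \<beta> \<mu> \<nu>) z = (\<nu> + 1) * K \<gamma> (\<alpha> - 1) (\<beta> - 1) \<mu> (\<nu> + 1) z"
  proof (rule exceptional)
    fix l m assume lm: "(h (\<nu> + 1) \<longlongrightarrow> l) (at_right 0)" "(h (\<nu> + 1) \<longlongrightarrow> m) (at_left 1)"
    have eqs: "h \<nu> = (\<lambda>s. h (\<nu> - 1) s * exp (log_curve \<gamma> s))"
      "h (\<nu> + 1) = (\<lambda>s. h (\<nu> - 1) s * exp (log_curve \<gamma> s) ^ 2)"
      using pw_shift[of \<gamma> _ _ "\<nu> - 1" 1] pw_shift[of \<gamma> _ _ "\<nu> - 1" 2]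
      by (auto simp: h_def exp_double add.commute)
    show "l = m"
    proof (rule boundary_vanishes_square[OF cont _ S(1)])
      show "continuous_on {0<..<1} (log_curve \<gamma>)"
        using adm by (simp add: admissible_def)
      show "(log_curve \<gamma> has_vector_derivative vector_derivative (curve \<gamma>) (at s) / curve \<gamma> s) (at s)"
        if "s \<in> {0<..<1} - S" for s
        using that by (intro log_curve_deriv[OF adm] S(2)) auto
      show "boundary_vanishes (h (\<nu> - 1))" "boundary_vanishes (\<lambda>s. h (\<nu> - 1) s * exp (log_curve \<gamma> s))"
        unfolding eqs(1)[symmetric] using assms(3,4) z by (auto simp: h_def)
      \<comment> \<open>This integrand is \<open>h (\<nu> + 1)\<close> times \<tau>'/\<tau>, so
        convergence of the right-hand side of the relation is the required integrability.\<close>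
      have "(\<lambda>s. kern \<gamma> (\<alpha> - 1) (\<beta> - 1) \<mu> (\<nu> + 1) z s / C) absolutely_integrable_on {0<..<1}"
        using assms(9) z by (intro set_integrable_divide) (auto simp: K_converges_def)
      thus "(\<lambda>s. h (\<nu> - 1) s * exp (log_curve \<gamma> s) ^ 2
          * (vector_derivative (curve \<gamma>) (at s) / curve \<gamma> s)) absolutely_integrable_on {0<..<1}"
      proof (rule absolutely_integrable_spike[OF _ negligible_empty])
        fix s :: real assume "s \<in> {0<..<1} - {}"
        hence s: "s \<in> {0<..<1}"
          by simp
        show "h (\<nu> - 1) s * exp (log_curve \<gamma> s) ^ 2 * (vector_derivative (curve \<gamma>) (at s) / curve \<gamma> s)
          = kern \<gamma> (\<alpha> - 1) (\<beta> - 1) \<mu> (\<nu> + 1) z s / C"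
          using h_eq[of 0 s] D[OF s] unfolding shifts(3)[OF s]
          by (simp add: field_simps power2_eq_square)
      qed
    qed (use lm in \<open>simp_all add: eqs(2)\<close>)
  next
    fix s :: real assume s: "s \<in> {0<..<1}"
    have "C * h' (\<nu> + 1) s = kern \<gamma> \<alpha> \<beta> \<mu> \<nu> z s * (curve \<gamma> s ^ 2 * ((\<alpha> + \<nu>) * (z $ M2 / curve \<gamma> s ^ 2 / fac1 \<gamma> z s)
       - (\<beta> + \<nu>) * (z $ M1 / curve \<gamma> s ^ 2 / fac2 \<gamma> z s) + (\<nu> + 1) / curve \<gamma> s))"
      using h_eq[of 2 s] D[OF s] unfolding h'_def by (simp add: exp_double add.commute[of 1])
    \<comment> \<open>The factor \<tau>^2 cancels the denominators: the terms of the two linear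
      factors give \<open>- b P1 P2 s\<close>, and the power of \<tau> gives the rest.\<close>
    also have "\<dots> = (\<nu> + 1) * kern \<gamma> (\<alpha> - 1) (\<beta> - 1) \<mu> (\<nu> + 1) z s - b P1 P2 s"
      using D[OF s] unfolding b_def pds[OF s] shifts[OF s]
      by (simp add: field_simps power2_eq_square)
    finally show "C * h' (\<nu> + 1) s = \<dots>" .
  qed (use assms in auto)
  moreover have "B M1 M2 (K \<gamma> \<alpha> \<beta> \<mu> \<nu>) z = - (\<alpha> + \<beta> + \<nu> + 1) * K \<gamma> (\<alpha> + 1) (\<beta> + 1) \<mu> (\<nu> - 1) z"
  proof (rule exceptional)
    fix l m assume lm: "(h (\<nu> - 1) \<longlongrightarrow> l) (at_right 0)" "(h (\<nu> - 1) \<longlongrightarrow> m) (at_left 1)"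
    obtain l' m' where "(h (\<nu> - 1) \<longlongrightarrow> l') (at_right 0)" "(h (\<nu> - 1) \<longlongrightarrow> m') (at_left 1)" "m' - l' = 0"
      using assms(3) z unfolding boundary_vanishes_def h_def by blast
    moreover from this lm have "l' = l" "m' = m"
      by (auto intro: tendsto_unique[rotated])
    ultimately show "l = m"
      by simp
  next
    fix s :: real assume s: "s \<in> {0<..<1}"
    have "C * h' (\<nu> - 1) s = kern \<gamma> \<alpha> \<beta> \<mu> \<nu> z s * ((\<alpha> + \<nu>) * (z $ M2 / curve \<gamma> s ^ 2 / fac1 \<gamma> z s)
       - (\<beta> + \<nu>) * (z $ M1 / curve \<gamma> s ^ 2 / fac2 \<gamma> z s) + (\<nu> - 1) / curve \<gamma> s)"
      using h_eq[of 0 s] unfolding h'_def by simp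
    \<comment> \<open>Substituting for z_1 and z_2 in \<open>b M1 M2\<close> splits off -(\<alpha> +
      \<beta> + 2\<nu>)/\<tau>; the coefficient arises as (\<alpha> + \<beta> + 2\<nu>) - (\<nu> -
      1).\<close>
    also have "\<dots> = - (\<alpha> + \<beta> + \<nu> + 1) * kern \<gamma> (\<alpha> + 1) (\<beta> + 1) \<mu> (\<nu> - 1) z s - b M1 M2 s"
      using D[OF s] unfolding b_def pds[OF s] shifts[OF s]
      by (simp add: fac1'[of s] fac2'[of s] field_simps power2_eq_square)
    finally show "C * h' (\<nu> - 1) s = \<dots>" .
  qed (use assms in auto)

  \<comment> \<open>Relations between the integrands\<close>
  \<comment> \<open>The coefficients z_1 and z_{-2} recombine to \<open>fac1\<close>, and in the
    next relation z_2 and z_{-1} to \<open>fac2\<close>.\<close>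
  moreover have "B M1 P2 (K \<gamma> \<alpha> \<beta> \<mu> \<nu>) z = (\<beta> + \<nu>) * K \<gamma> (\<alpha> + 1) (\<beta> - 1) \<mu> \<nu> z"
  proof (rule rel, goal_cases)
    case (1 s)
    show ?case
      using D[OF 1] unfolding b_def pds[OF 1] shifts[OF 1] by (simp add: fac1'[of s] field_simps)
  qed
  moreover have "B P1 M2 (K \<gamma> \<alpha> \<beta> \<mu> \<nu>) z = - (\<alpha> + \<nu>) * K \<gamma> (\<alpha> - 1) (\<beta> + 1) \<mu> \<nu> z"
  proof (rule rel, goal_cases)
    case (1 s)
    show ?case
      using D[OF 1] unfolding b_def pds[OF 1] shifts[OF 1] by (simp add: fac2'[of s] field_simps)
  qed
  \<comment> \<open>Here and in the remaining relations the integrand does not depend on z_{-3}, so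
    only the term with coefficient -z_3 survives.\<close>
  moreover have "B P1 M3 (K \<gamma> \<alpha> \<beta> \<mu> \<nu>) z = - (\<alpha> + \<nu>) * K \<gamma> (\<alpha> - 1) \<beta> (\<mu> + 1) \<nu> z"
  proof (rule rel, goal_cases)
    case (1 s)
    show ?case
      using D[OF 1] unfolding b_def pds[OF 1] shifts[OF 1] by (simp add: field_simps)
  qed
  moreover have "B M1 M3 (K \<gamma> \<alpha> \<beta> \<mu> \<nu>) z = - (\<beta> + \<nu>) * K \<gamma> (\<alpha> + 1) \<beta> (\<mu> + 1) (\<nu> - 1) z"
  proof (rule rel, goal_cases)
    case (1 s)
    show ?case
      using D[OF 1] unfolding b_def pds[OF 1] shifts[OF 1] by (simp add: field_simps)
  qed
  moreover have "B P2 M3 (K \<gamma> \<alpha> \<beta> \<mu> \<nu>) z = - (\<beta> + \<nu>) * K \<gamma> \<alpha> (\<beta> - 1) (\<mu> + 1) \<nu> z"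
  proof (rule rel, goal_cases)
    case (1 s)
    show ?case
      using D[OF 1] unfolding b_def pds[OF 1] shifts[OF 1] by (simp add: field_simps)
  qed
  moreover have "B M2 M3 (K \<gamma> \<alpha> \<beta> \<mu> \<nu>) z = (\<alpha> + \<nu>) * K \<gamma> \<alpha> (\<beta> + 1) (\<mu> + 1) (\<nu> - 1) z"
  proof (rule rel, goal_cases)
    case (1 s)
    show ?case
      using D[OF 1] unfolding b_def pds[OF 1] shifts[OF 1] by (simp add: field_simps)
  qed
  ultimately show "?G z"
    by blast
qed

end
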